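(* Let $A\in\mathbb{C}^{n\times n}$ be a singular irreducible row diagonally dominant matrix, and let $\Upsilon$ be the right eigenvector matrix corresponding to the zero eigenvalue of $A$. Then $$\Upsilon^{-1}A\Upsilon=\mathcal{D}(A)\,(I-S)$$ for some Markov matrix $S\in\mathbb{R}^{n\times n}$, where $I$ is the identity matrix.
   Context: A matrix $A=[a_{ij}]\in\mathbb{C}^{n\times n}$ is row diagonally dominant if $|a_{ii}|\ge\sum_{j\ne i}|a_{ij}|$ for every $i$. The associated directed graph of $A$ has vertices $v_1,\dots,v_n$ and an edge $(v_i,v_j)$ exactly when $a_{ij}\ne0$; $A$ is irreducible if this graph is strongly connected (every vertex is reachable from every other vertex). If $\gamma=(\gamma_1,\dots,\gamma_n)^{T}$ is a right eigenvector corresponding to the zero eigenvalue of $A$ ($A\gamma=0$, $\gamma\neq0$), the diagonal matrix $\Upsilon=\mathrm{diag}(\gamma_1,\dots,\gamma_n)$ is called the right eigenvector matrix associated with the zero eigenvalue of $A$; for singular irreducible row diagonally dominant $A$ it is nonsingular. $\mathcal{D}(A)=\mathrm{diag}(a_{11},\dots,a_{nn})$ is the diagonal matrix formed by the diagonal entries of $A$. A real matrix $S=[s_{ij}]$ is a Markov matrix if $s_{ij}\ge0$ for all $i,j$ and $\sum_{j=1}^n s_{ij}=1$ for all $i$. *)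

theory Defs
  imports "HOL-Analysis.Analysis"
begin

definition row_diagonally_dominant :: "complex ^ 'n ^ 'n \<Rightarrow> bool" where
  "row_diagonally_dominant A \<longleftrightarrow>
     (\<forall>i. norm (A $ i $ i) \<ge> (\<Sum>j\<in>UNIV - {i}. norm (A $ i $ j)))"

definition matrix_digraph :: "complex ^ 'n ^ 'n \<Rightarrow> ('n \<times> 'n) set" where
  "matrix_digraph A = {(i, j). A $ i $ j \<noteq> 0}"

(* The reflexive closure means that a 1 x 1 matrix is always irreducible, the zero matrix
   included: its single vertex has no other vertex to reach. *)
definition irreducible_matrix :: "complex ^ 'n ^ 'n \<Rightarrow> bool" where
  "irreducible_matrix A \<longleftrightarrow> (\<forall>i j. (i, j) \<in> (matrix_digraph A)\<^sup>*)"

definition diag_matrix :: "complex ^ 'n \<Rightarrow> complex ^ 'n ^ 'n" where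
  "diag_matrix v = (\<chi> i j. if i = j then v $ i else 0)"

definition diag_part :: "complex ^ 'n ^ 'n \<Rightarrow> complex ^ 'n ^ 'n" where
  "diag_part A = diag_matrix (\<chi> i. A $ i $ i)"

definition zero_right_eigenvector :: "complex ^ 'n ^ 'n \<Rightarrow> complex ^ 'n \<Rightarrow> bool" where
  "zero_right_eigenvector A \<gamma> \<longleftrightarrow> A *v \<gamma> = 0 \<and> \<gamma> \<noteq> 0"

(* The eigenvector is unique only up to a nonzero scalar, hence a relation. *)
definition right_eigenvector_matrix :: "complex ^ 'n ^ 'n \<Rightarrow> complex ^ 'n ^ 'n \<Rightarrow> bool" where
  "right_eigenvector_matrix A U \<longleftrightarrow>
     (\<exists>\<gamma>. zero_right_eigenvector A \<gamma> \<and> U = diag_matrix \<gamma>)"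

definition markov_matrix :: "real ^ 'n ^ 'n \<Rightarrow> bool" where
  "markov_matrix S \<longleftrightarrow>
     (\<forall>i j. S $ i $ j \<ge> 0) \<and> (\<forall>i. (\<Sum>j\<in>UNIV. S $ i $ j) = 1)"

end

theory Submission
  imports Defs
begin

text \<open>
  The theorem rests on two equality cases. Let \<open>A\<close> be diagonally dominant and irreducible with
  \<open>A *v \<gamma> = 0\<close>, \<open>\<gamma> \<noteq> 0\<close>. At an index where \<open>\<bar>\<gamma>\<bar>\<close> is largest, the estimate of \<open>\<bar>a\<^sub>i\<^sub>i \<gamma>\<^sub>i\<bar>\<close> by the
  off-diagonal terms leaves no slack, so \<open>\<bar>\<gamma>\<bar>\<close> is also largest at every out-neighbour
  (\<open>max_norm_spreads_along_edge\<close>). Irreducibility then spreads this to all indices: all entries of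
  \<open>\<gamma>\<close> have the same nonzero modulus (\<open>null_vector_constant_norm\<close>), and \<open>diag_matrix \<gamma>\<close> is
  invertible.

  Conjugation by \<open>diag_matrix \<gamma>\<close> therefore replaces \<open>a\<^sub>i\<^sub>j\<close> by \<open>b\<^sub>i\<^sub>j = a\<^sub>i\<^sub>j \<gamma>\<^sub>j / \<gamma>\<^sub>i\<close>, which has the
  same modulus and the same diagonal, but now every row sums to zero. Thus \<open>- b\<^sub>i\<^sub>i\<close> is the
  sum of numbers whose moduli add up to at most \<open>\<bar>b\<^sub>i\<^sub>i\<bar>\<close>. Equality in the triangle inequality forces
  each of them to be a nonnegative real multiple of \<open>- b\<^sub>i\<^sub>i\<close>
  (\<open>zero_sum_dominant_row\<close>), and these multiples are the off-diagonal entries of \<open>S\<close>.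
  A zero diagonal entry occurs only in a zero row, where the corresponding row of the identity
  serves as a row of \<open>S\<close>.
\<close>

lemma diag_matrix_mult_nth:
  "(diag_matrix v ** B) $ i $ j = v $ i * B $ i $ j"
  by (simp add: diag_matrix_def matrix_matrix_mult_def if_distrib[of "\<lambda>x. x * _"] cong: if_cong)

lemma mult_diag_matrix_nth:
  "(B ** diag_matrix v) $ i $ j = B $ i $ j * v $ j"
  by (simp add: diag_matrix_def matrix_matrix_mult_def if_distrib cong: if_cong)

lemma
  assumes "\<And>i. v $ i \<noteq> 0"
  shows invertible_diag_matrix: "invertible (diag_matrix v)"
    and matrix_inv_diag_matrix: "matrix_inv (diag_matrix v) = diag_matrix (\<chi> i. inverse (v $ i))"
proof -
  let ?w = "diag_matrix (\<chi> i. inverse (v $ i))"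
  have r: "diag_matrix v ** ?w = mat 1"
    by (simp add: vec_eq_iff diag_matrix_mult_nth) (simp add: diag_matrix_def mat_def assms)
  have l: "?w ** diag_matrix v = mat 1"
    by (simp add: vec_eq_iff diag_matrix_mult_nth) (simp add: diag_matrix_def mat_def assms)
  show "invertible (diag_matrix v)"
    using r l unfolding invertible_def by blast
  show "matrix_inv (diag_matrix v) = ?w"
  proof -
    have "matrix_inv (diag_matrix v) ** diag_matrix v = mat 1"
      unfolding matrix_inv_def by (rule someI2[of _ ?w]) (auto simp: r l)
    then have "matrix_inv (diag_matrix v) ** diag_matrix v ** ?w = ?w"
      by simp
    then show ?thesis
      by (simp add: r flip: matrix_mul_assoc)
  qed
qed

text \<open>
  The equality case of the triangle inequality, normalised to total \<open>1\<close>: the real parts already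
  add up to \<open>1\<close>, so no modulus can exceed its real part.
\<close>

lemma sum_eq_1_norm_le_1_imp_nonneg_real:
  fixes z :: "'a \<Rightarrow> complex"
  assumes fin: "finite J" and sum: "(\<Sum>j\<in>J. z j) = 1"
    and le: "(\<Sum>j\<in>J. norm (z j)) \<le> 1" and j: "j \<in> J"
  shows "z j = complex_of_real (norm (z j))"
proof -
  have "(\<Sum>j\<in>J. Re (z j)) = 1"
    using arg_cong[OF sum, of Re] by simp
  then have "(\<Sum>j\<in>J. norm (z j) - Re (z j)) \<le> 0"
    using le by (simp add: sum_subtractf)
  moreover have nn: "\<And>j. 0 \<le> norm (z j) - Re (z j)"
    by (simp add: complex_Re_le_cmod)
  ultimately have "(\<Sum>j\<in>J. norm (z j) - Re (z j)) = 0"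
    by (meson nn order_antisym sum_nonneg)
  then have re: "Re (z j) = norm (z j)"
    using sum_nonneg_eq_0_iff[OF fin nn] j by auto
  then have "Im (z j) = 0"
    using cmod_power2[of "z j"] by simp
  then show ?thesis
    using re by (simp add: complex_eq_iff)
qed

text \<open>
  Dividing the row by \<open>- b i\<close> puts it in the situation of the preceding lemma.
  If \<open>b i = 0\<close>, dominance makes the whole row zero.
\<close>

lemma zero_sum_dominant_row:
  fixes b :: "'n::finite \<Rightarrow> complex"
  assumes sum: "(\<Sum>j\<in>UNIV. b j) = 0"
    and dom: "(\<Sum>j\<in>UNIV - {i}. norm (b j)) \<le> norm (b i)"
  shows "(\<Sum>j\<in>UNIV - {i}. norm (b j)) = norm (b i)"
    and "j \<noteq> i \<Longrightarrow> b j = - b i * complex_of_real (norm (b j) / norm (b i))"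
proof -
  have off: "(\<Sum>j\<in>UNIV - {i}. b j) = - b i"
    using sum sum.remove[of UNIV i b] by (simp add: add_eq_0_iff)
  show "(\<Sum>j\<in>UNIV - {i}. norm (b j)) = norm (b i)"
    using dom norm_sum[of b "UNIV - {i}"] off by simp
  assume j: "j \<noteq> i"
  show "b j = - b i * complex_of_real (norm (b j) / norm (b i))"
  proof (cases "b i = 0")
    case True
    then have "(\<Sum>j\<in>UNIV - {i}. norm (b j)) = 0"
      using dom by (simp add: order_antisym sum_nonneg)
    then show ?thesis
      using j True by (simp add: sum_nonneg_eq_0_iff)
  next
    case False
    let ?z = "\<lambda>j. b j / - b i"
    have "?z j = complex_of_real (norm (?z j))"
    proof (rule sum_eq_1_norm_le_1_imp_nonneg_real[where z = ?z and J = "UNIV - {i}"])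
      show "(\<Sum>j\<in>UNIV - {i}. ?z j) = 1"
        unfolding sum_divide_distrib[symmetric] off using False by simp
      have "(\<Sum>j\<in>UNIV - {i}. norm (?z j)) = (\<Sum>j\<in>UNIV - {i}. norm (b j)) / norm (b i)"
        by (simp add: norm_divide sum_divide_distrib)
      also have "\<dots> \<le> 1"
        using dom False by simp
      finally show "(\<Sum>j\<in>UNIV - {i}. norm (?z j)) \<le> 1" .
    qed (use j in auto)
    moreover have "b j = - b i * ?z j"
      using False by simp
    ultimately show ?thesis
      by (metis norm_divide norm_minus_cancel)
  qed
qed

text \<open>
  The local step of the maximum principle: in the row of a maximiser \<open>i\<close>, the defects
  \<open>norm (\<gamma> $ i) - norm (\<gamma> $ k)\<close>, weighted by \<open>norm (A $ i $ k)\<close>, are nonnegative, and by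
  dominance they cannot have a positive sum.
\<close>

lemma max_norm_spreads_along_edge:
  fixes A :: "complex ^ 'n ^ 'n"
  assumes dom: "row_diagonally_dominant A" and null: "A *v \<gamma> = 0"
    and max: "\<And>k. norm (\<gamma> $ k) \<le> norm (\<gamma> $ i)" and edge: "A $ i $ j \<noteq> 0"
  shows "norm (\<gamma> $ j) = norm (\<gamma> $ i)"
proof (cases "j = i")
  case False
  let ?J = "UNIV - {i}"
  let ?d = "\<lambda>k. norm (A $ i $ k) * (norm (\<gamma> $ i) - norm (\<gamma> $ k))"
  have "(\<Sum>k\<in>UNIV. A $ i $ k * \<gamma> $ k) = 0"
    using null by (simp add: vec_eq_iff matrix_vector_mult_def)
  then have "A $ i $ i * \<gamma> $ i = - (\<Sum>k\<in>?J. A $ i $ k * \<gamma> $ k)"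
    using sum.remove[of UNIV i "\<lambda>k. A $ i $ k * \<gamma> $ k"] by (simp add: eq_neg_iff_add_eq_0)
  then have "norm (A $ i $ i) * norm (\<gamma> $ i) \<le> (\<Sum>k\<in>?J. norm (A $ i $ k) * norm (\<gamma> $ k))"
    using norm_sum[of "\<lambda>k. A $ i $ k * \<gamma> $ k" ?J]
    by (metis (no_types, lifting) norm_minus_cancel norm_mult sum.cong)
  moreover have "(\<Sum>k\<in>?J. norm (A $ i $ k)) * norm (\<gamma> $ i) \<le> norm (A $ i $ i) * norm (\<gamma> $ i)"
    using dom by (intro mult_right_mono) (auto simp: row_diagonally_dominant_def)
  ultimately have "sum ?d ?J \<le> 0"
    by (simp add: right_diff_distrib sum_subtractf sum_distrib_right)
  moreover have nn: "\<And>k. 0 \<le> ?d k"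
    using max by simp
  ultimately have "sum ?d ?J = 0"
    by (meson nn order_antisym sum_nonneg)
  then have "?d j = 0"
    using sum_nonneg_eq_0_iff[of ?J ?d] nn False by auto
  then show ?thesis
    using edge by simp
qed simp

lemma null_vector_constant_norm:
  fixes A :: "complex ^ 'n ^ 'n"
  assumes irr: "irreducible_matrix A" and dom: "row_diagonally_dominant A"
    and null: "A *v \<gamma> = 0"
  shows "norm (\<gamma> $ i) = norm (\<gamma> $ j)"
proof -
  have "Max (range (\<lambda>k. norm (\<gamma> $ k))) \<in> range (\<lambda>k. norm (\<gamma> $ k))"
    by (rule Max_in) auto
  then obtain m where "Max (range (\<lambda>k. norm (\<gamma> $ k))) = norm (\<gamma> $ m)"
    by (elim imageE) (rule that)
  then have m: "norm (\<gamma> $ k) \<le> norm (\<gamma> $ m)" for k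
    using Max_ge[of "range (\<lambda>k. norm (\<gamma> $ k))" "norm (\<gamma> $ k)"] by simp
  have "norm (\<gamma> $ k) = norm (\<gamma> $ m)" for k
  proof -
    have "(m, k) \<in> (matrix_digraph A)\<^sup>*"
      using irr by (simp add: irreducible_matrix_def)
    then show ?thesis
    proof (induction rule: rtrancl_induct)
      case (step k l)
      then show ?case
        using max_norm_spreads_along_edge[OF dom null, of k l] m by (simp add: matrix_digraph_def)
    qed simp
  qed
  then show ?thesis
    by metis
qed

theorem theorem3p1:
  fixes A U :: "complex ^ 'n ^ 'n"
  assumes "\<not> invertible A"
    and "irreducible_matrix A"
    and "row_diagonally_dominant A"
    and "right_eigenvector_matrix A U"
  shows "invertible U \<and>
    (\<exists>S :: real ^ 'n ^ 'n. markov_matrix S \<and>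
       matrix_inv U ** A ** U = diag_part A ** (mat 1 - map_matrix complex_of_real S))"
proof -
  obtain \<gamma> where null: "A *v \<gamma> = 0" and "\<gamma> \<noteq> 0" and U: "U = diag_matrix \<gamma>"
    using assms(4) by (auto simp: right_eigenvector_matrix_def zero_right_eigenvector_def)
  have const: "norm (\<gamma> $ i) = norm (\<gamma> $ j)" for i j
    using null_vector_constant_norm[OF assms(2,3) null] .
  have nz: "\<gamma> $ i \<noteq> 0" for i
    using \<open>\<gamma> \<noteq> 0\<close> const[of i] by (metis norm_eq_zero vec_eq_iff zero_index)
  define b where "b = (\<lambda>i j. inverse (\<gamma> $ i) * A $ i $ j * \<gamma> $ j)"
  have conj: "(matrix_inv U ** A ** U) $ i $ j = b i j" for i j
    by (simp add: U b_def matrix_inv_diag_matrix[OF nz] mult_diag_matrix_nth diag_matrix_mult_nth)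
  have diag: "b i i = A $ i $ i" for i
    using nz[of i] by (simp add: b_def)
  have norm_b: "norm (b i j) = norm (A $ i $ j)" for i j
    using nz[of j] by (simp add: b_def norm_mult norm_inverse const[of i j])
  have sum_b: "(\<Sum>j\<in>UNIV. b i j) = 0" for i
  proof -
    have "(\<Sum>j\<in>UNIV. b i j) = inverse (\<gamma> $ i) * (\<Sum>j\<in>UNIV. A $ i $ j * \<gamma> $ j)"
      by (simp add: b_def sum_distrib_left mult.assoc)
    also have "\<dots> = 0"
      using null by (simp add: vec_eq_iff matrix_vector_mult_def)
    finally show ?thesis .
  qed
  have dom_b: "(\<Sum>j\<in>UNIV - {i}. norm (b i j)) \<le> norm (b i i)" for i
    using assms(3) by (simp add: norm_b row_diagonally_dominant_def)
  note row = zero_sum_dominant_row[OF sum_b dom_b]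

  \<comment> \<open>If the diagonal entry of a row vanishes, division by zero makes the off-diagonal entries
    of \<open>S\<close> zero there, so that row of \<open>S\<close> is the one of the identity.\<close>
  define S :: "real ^ 'n ^ 'n" where
    "S = (\<chi> i j. if i = j then (if b i i = 0 then 1 else 0) else norm (b i j) / norm (b i i))"
  have "markov_matrix S"
    unfolding markov_matrix_def
  proof (intro conjI allI)
    show "0 \<le> S $ i $ j" for i j
      by (simp add: S_def)
    fix i
    have "(\<Sum>j\<in>UNIV - {i}. S $ i $ j) = (\<Sum>j\<in>UNIV - {i}. norm (b i j)) / norm (b i i)"
      unfolding sum_divide_distrib by (rule sum.cong) (auto simp: S_def)
    then show "(\<Sum>j\<in>UNIV. S $ i $ j) = 1"
      using sum.remove[of UNIV i "\<lambda>j. S $ i $ j"] row(1)[of i] by (simp add: S_def)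
  qed
  moreover have "matrix_inv U ** A ** U = diag_part A ** (mat 1 - map_matrix complex_of_real S)"
  proof -
    have "b i j = A $ i $ i * ((if i = j then 1 else 0) - complex_of_real (S $ i $ j))" for i j
    proof (cases "i = j")
      case False
      then show ?thesis
        using row(2)[of j i] by (simp add: S_def diag)
    qed (simp add: S_def diag)
    then show ?thesis
      by (simp add: vec_eq_iff conj diag_part_def diag_matrix_mult_nth map_matrix_def mat_def)
  qed
  moreover have "invertible U"
    unfolding U by (rule invertible_diag_matrix[OF nz])
  ultimately show ?thesis
    by blast
qed

end
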